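(* Let $\theta\in(0,\pi/2)$ and $z=\ln(\sin\theta)/\ln[(\cos\theta)/2]$. If $z\ne 1/3$, then every hierarchical tiling of the plane with basic angle $\theta$ is not periodic.
   Context: Fix positive reals $a,b,c$ with $a^2+b^2=c^2$ and let $\theta=\arcsin(a/c)\in(0,\pi/2)$. A tile is a right triangle with an ordered triple of vertices $(A,C,B)$, with right angle at $C$ and angle $\theta$ at $A$, so that $|AC|:|CB|:|AB|=b:a:c$. $AC$ is called the long leg and $CB$ the short leg (even if $b\le a$). Subdivision rule: let $F$ be the foot of the perpendicular from $C$ to $AB$, and let $M,N,K$ be the midpoints of $AC$, $AF$, $FC$. The tile $(A,C,B)$ is divided into the five daughter tiles $(A,N,M)$, $(M,K,C)$, $(M,K,F)$, $(F,N,M)$ (each smaller than the parent by the linear factor $b/(2c)$) and $(C,F,B)$ (smaller by the linear factor $a/c$). Let $T$ be the basic tile with hypotenuse $c$. Put $T_0=\{T\}$, and for $n\ge1$ let $T_n$ be obtained from $T_{n-1}$ by subdividing every tile of $T_{n-1}$ that has the largest hypotenuse occurring in $T_{n-1}$. A supertile of order $n$ is a collection of tiles of the form $e(s(T_n))$, where $s$ is a rescaling and $e$ is a Euclidean motion (possibly orientation reversing). A hierarchical tiling of the plane with basic angle $\theta$ is a tiling of the plane that is the union of supertiles $S_1\subsetneq S_2\subsetneq\cdots$ of orders $N_1<N_2<\cdots$, where for each $i$, writing $S_{i+1}=e(s(T_{N_{i+1}}))$, there are $n\le N_{i+1}$ and a tile $t\in T_n$ such that $S_i$ is the image under $e\circ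 s$ of the set of tiles of $T_{N_{i+1}}$ contained in $t$. A tiling of the plane is periodic if it is invariant under two linearly independent translations. *)

theory Defs
  imports "HOL-Analysis.Analysis"
begin

type_synonym point = "real ^ 2"

text \<open>A tile is its ordered vertex triple \<open>(A, C, B)\<close>, with the right angle at the middle
  vertex \<open>C\<close> and the basic angle at \<open>A\<close>; the region it occupies is \<open>region (A, C, B)\<close>.\<close>

type_synonym tile = "point \<times> point \<times> point"

definition vertex_angle :: "point \<Rightarrow> point \<Rightarrow> point \<Rightarrow> real" where
  "vertex_angle P Q R = arccos (((P - Q) \<bullet> (R - Q)) / (norm (P - Q) * norm (R - Q)))"

fun is_tile :: "real \<Rightarrow> tile \<Rightarrow> bool" where
  "is_tile \<theta> (A, C, B) \<longleftrightarrow>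
     A \<noteq> C \<and> C \<noteq> B \<and> A \<noteq> B \<and> vertex_angle A C B = pi / 2 \<and> vertex_angle C A B = \<theta>"

fun region :: "tile \<Rightarrow> point set" where
  "region (A, C, B) = convex hull {A, C, B}"

fun hypotenuse :: "tile \<Rightarrow> real" where
  "hypotenuse (A, C, B) = dist A B"

fun map_tile :: "(point \<Rightarrow> point) \<Rightarrow> tile \<Rightarrow> tile" where
  "map_tile f (A, C, B) = (f A, f C, f B)"

definition perp_foot :: "point \<Rightarrow> point \<Rightarrow> point \<Rightarrow> point" where
  "perp_foot C A B = A + (((C - A) \<bullet> (B - A)) / ((B - A) \<bullet> (B - A))) *\<^sub>R (B - A)"

lemma perp_foot_in_line: "perp_foot C A B \<in> affine hull {A, B}"
  unfolding perp_foot_def affine_hull_2_alt by blast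

lemma perp_foot_perpendicular:
  assumes "A \<noteq> B"
  shows "(C - perp_foot C A B) \<bullet> (B - A) = 0"
proof -
  define k where "k = ((C - A) \<bullet> (B - A)) / ((B - A) \<bullet> (B - A))"
  have "(B - A) \<bullet> (B - A) \<noteq> 0" using assms by simp
  then have "k * ((B - A) \<bullet> (B - A)) = (C - A) \<bullet> (B - A)"
    unfolding k_def by (rule nonzero_eq_divide_eq[THEN iffD1, OF _ refl])
  moreover have "C - perp_foot C A B = (C - A) - k *\<^sub>R (B - A)"
    by (simp add: perp_foot_def k_def)
  ultimately show ?thesis
    by (simp only: inner_diff_left[of "C - A"] inner_scaleR_left)
qed

fun daughters :: "tile \<Rightarrow> tile set" where
  "daughters (A, C, B) =
     (let F = perp_foot C A B; M = midpoint A C; N = midpoint A F; K = midpoint F C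
      in {(A, N, M), (M, K, C), (M, K, F), (F, N, M), (C, F, B)})"

definition subdivide_largest :: "tile set \<Rightarrow> tile set" where
  "subdivide_largest X =
     (\<Union>t\<in>X. if hypotenuse t = Max (hypotenuse ` X) then daughters t else {t})"

text \<open>The basic tile has long leg \<open>b\<close> and short leg \<open>a\<close>. Its position is immaterial, since
  supertiles are taken up to Euclidean motions.\<close>

definition basic_tile :: "real \<Rightarrow> real \<Rightarrow> tile" where
  "basic_tile a b = (vector [b, 0], vector [0, 0], vector [0, a])"

fun stage :: "real \<Rightarrow> real \<Rightarrow> nat \<Rightarrow> tile set" where
  "stage a b 0 = {basic_tile a b}"
| "stage a b (Suc n) = subdivide_largest (stage a b n)"

lemma finite_stage: "finite (stage a b n)"
proof -
  have "finite (daughters t)" for t by (cases t) (simp add: Let_def)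
  then show ?thesis by (induction n) (auto simp: subdivide_largest_def)
qed

definition euclidean_motion :: "(point \<Rightarrow> point) \<Rightarrow> bool" where
  "euclidean_motion e \<longleftrightarrow> (\<forall>x y. dist (e x) (e y) = dist x y)"

definition rescaling :: "(point \<Rightarrow> point) \<Rightarrow> bool" where
  "rescaling s \<longleftrightarrow> (\<exists>r>0. s = (\<lambda>x. r *\<^sub>R x))"

definition supertile :: "real \<Rightarrow> real \<Rightarrow> nat \<Rightarrow> tile set \<Rightarrow> bool" where
  "supertile a b n S \<longleftrightarrow>
     (\<exists>e s. euclidean_motion e \<and> rescaling s \<and> S = map_tile (e \<circ> s) ` stage a b n)"

definition plane_tiling :: "real \<Rightarrow> tile set \<Rightarrow> bool" where
  "plane_tiling \<theta> \<T> \<longleftrightarrow>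
     (\<forall>t\<in>\<T>. is_tile \<theta> t) \<and>
     (\<Union>t\<in>\<T>. region t) = UNIV \<and>
     (\<forall>t\<in>\<T>. \<forall>t'\<in>\<T>. t \<noteq> t' \<longrightarrow> interior (region t) \<inter> interior (region t') = {})"

definition hierarchical_tiling :: "real \<Rightarrow> real \<Rightarrow> real \<Rightarrow> tile set \<Rightarrow> bool" where
  "hierarchical_tiling a b c \<T> \<longleftrightarrow>
     plane_tiling (arcsin (a / c)) \<T> \<and>
     (\<exists>(S :: nat \<Rightarrow> tile set) (N :: nat \<Rightarrow> nat).
        \<T> = (\<Union>i. S i) \<and>
        strict_mono N \<and>
        (\<forall>i. supertile a b (N i) (S i)) \<and>
        (\<forall>i. S i \<subset> S (Suc i)) \<and>
        (\<forall>i. \<exists>e s. euclidean_motion e \<and> rescaling s \<and>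
           S (Suc i) = map_tile (e \<circ> s) ` stage a b (N (Suc i)) \<and>
           (\<exists>n\<le>N (Suc i). \<exists>t\<in>stage a b n.
              S i = map_tile (e \<circ> s) `
                {t' \<in> stage a b (N (Suc i)). region t' \<subseteq> region t})))"

definition periodic :: "tile set \<Rightarrow> bool" where
  "periodic \<T> \<longleftrightarrow>
     (\<exists>u v. u \<noteq> v \<and> independent {u, v} \<and>
        map_tile (\<lambda>x. u + x) ` \<T> = \<T> \<and> map_tile (\<lambda>x. v + x) ` \<T> = \<T>)"

end

theory Submission
  imports Defs
    "HOL-Computational_Algebra.Fundamental_Theorem_Algebra"
    "HOL-Computational_Algebra.Primes"
begin

text \<open>A periodic tiling by right triangles of bounded size has only finitely many tiles up to
  translation, so it suffices that the number of distinct pairs of leg vectors in \<open>T\<^sub>n\<close> is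
  unbounded. Passing \<open>i\<close> times to the daughter \<open>(M, K, F)\<close> multiplies the size by
  \<open>(cos \<theta>)/2\<close> and rotates by \<open>\<theta>\<close> each time; afterwards the daughter \<open>(C, F, B)\<close> multiplies
  by \<open>sin \<theta>\<close>, and taken twice it does not rotate. For each \<open>i\<close> a late stage contains a tile of
  this kind. If two of them with different \<open>i\<close> have the same legs, then \<open>\<theta>/\<pi>\<close> is rational and
  \<open>(sin \<theta>)\<^sup>q = ((cos \<theta>)/2)\<^sup>p\<close> for some positive \<open>p\<close>, \<open>q\<close>.

  For rational \<open>\<theta>/\<pi>\<close> all conjugates of \<open>w = 2 cos 2\<theta>\<close> lie in \<open>[-2, 2]\<close> and satisfy the same
  equation \<open>((2 - w)/4)\<^sup>q = ((2 + w)/16)\<^sup>p\<close>, which by monotonicity has only one solution there.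
  So \<open>w\<close> is rational, hence an integer, and only \<open>w = 0\<close> survives: \<open>\<theta> = \<pi>/4\<close> and \<open>z = 1/3\<close>.\<close>

subsection \<open>Cosines of rational multiples of \<open>\<pi>\<close>\<close>

text \<open>Rational polynomials stay inside \<open>complex poly\<close>, so that complex roots and
  algebraic closedness are available without an embedding of coefficients.\<close>

definition rat_poly :: "complex poly \<Rightarrow> bool" where
  "rat_poly p \<longleftrightarrow> (\<forall>i. coeff p i \<in> \<rat>)"

lemma rat_poly_diff: "rat_poly p \<Longrightarrow> rat_poly q \<Longrightarrow> rat_poly (p - q)"
  by (auto simp: rat_poly_def)

lemma rat_poly_mult: "rat_poly p \<Longrightarrow> rat_poly q \<Longrightarrow> rat_poly (p * q)"
  by (auto simp: rat_poly_def coeff_mult intro!: Rats_sum Rats_mult)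

lemma rat_poly_pCons: "a \<in> \<rat> \<Longrightarrow> rat_poly p \<Longrightarrow> rat_poly (pCons a p)"
  by (auto simp: rat_poly_def coeff_pCons split: nat.split)

lemma rat_poly_0: "rat_poly 0" and rat_poly_1: "rat_poly 1"
  by (auto simp: rat_poly_def)

lemma rat_poly_power: "rat_poly p \<Longrightarrow> rat_poly (p ^ n)"
  by (induction n) (auto simp: rat_poly_1 intro!: rat_poly_mult)

lemma rat_poly_monom: "a \<in> \<rat> \<Longrightarrow> rat_poly (monom a n)"
  by (auto simp: rat_poly_def)

lemma rat_poly_pderiv: "rat_poly p \<Longrightarrow> rat_poly (pderiv p)"
  by (auto simp: rat_poly_def coeff_pderiv intro!: Rats_mult Rats_add)

text \<open>Division with remainder, one leading term at a time: subtracting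
  \<open>monom c n * f\<close> with rational \<open>c\<close> lowers the degree and keeps the root
  \<open>w\<close>. Thus \<open>f\<close> is a minimal polynomial of \<open>w\<close> up to a
  constant.\<close>

lemma minimal_rat_poly_dvd:
  assumes f: "rat_poly f" "f \<noteq> 0" "poly f w = 0"
    and min: "\<And>p. rat_poly p \<Longrightarrow> p \<noteq> 0 \<Longrightarrow> poly p w = 0 \<Longrightarrow> degree f \<le> degree p"
  shows "rat_poly p \<Longrightarrow> poly p w = 0 \<Longrightarrow> f dvd p"
proof (induction "degree p" arbitrary: p rule: less_induct)
  case less
  show ?case
  proof (cases "p = 0")
    case False
    define c where "c = lead_coeff p / lead_coeff f"
    define n where "n = degree p - degree f"
    define r where "r = p - monom c n * f"
    have le: "degree f \<le> degree p" using min less.prems False by blast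
    have c: "c \<noteq> 0" "c \<in> \<rat>"
      using f less.prems False by (auto simp: c_def rat_poly_def)
    have r: "rat_poly r" "poly r w = 0"
      using less.prems f c
      by (auto simp: r_def intro!: rat_poly_diff rat_poly_mult rat_poly_monom)
    have deg: "degree (monom c n * f) = degree p"
      using c f le by (simp add: degree_mult_eq degree_monom_eq n_def)
    have "coeff (monom c n * f) (degree p) = lead_coeff p"
      using f le by (simp add: coeff_monom_mult n_def c_def)
    then have "r = 0 \<or> degree r < degree p"
      by (intro eq_zero_or_degree_less) (auto simp: r_def deg intro!: degree_diff_le)
    then have "f dvd r" using less.hyps[of r] r by auto
    then have "f dvd r + monom c n * f" by simp
    then show ?thesis by (simp add: r_def)
  qed simp
qed

text \<open>A minimal polynomial of \<open>w\<close> divides both \<open>G\<close> and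
  \<open>H\<close>, so \<open>w\<close> is its only root. Were its degree above 1, \<open>w\<close>
  would be a multiple root and the derivative a rational polynomial of smaller degree vanishing at
  \<open>w\<close>. So it is linear.\<close>

lemma rational_if_only_common_root:
  assumes G: "rat_poly G" "poly G w = 0" and H: "rat_poly H" "poly H w = 0" "H \<noteq> 0"
    and only: "\<And>x. poly G x = 0 \<Longrightarrow> poly H x = 0 \<Longrightarrow> x = w"
  shows "w \<in> \<rat>"
proof -
  define P where "P f \<longleftrightarrow> rat_poly f \<and> f \<noteq> 0 \<and> poly f w = 0" for f
  obtain f where Pf: "P f" and min: "\<And>p. P p \<Longrightarrow> degree f \<le> degree p"
    using ex_has_least_nat[of P H degree] H unfolding P_def by blast
  have f: "rat_poly f" "f \<noteq> 0" "poly f w = 0" using Pf by (auto simp: P_def)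
  have dvd: "f dvd p" if "rat_poly p" "poly p w = 0" for p
    using minimal_rat_poly_dvd[OF f _ that] min by (auto simp: P_def)
  have root: "x = w" if "poly f x = 0" for x
    using only[of x] dvd[OF G] dvd[OF H(1,2)] that by (auto elim!: dvdE)
  obtain h where h: "f = [:- w, 1:] * h"
    using f(3) by (metis poly_eq_0_iff_dvd dvdE)
  have hnz: "h \<noteq> 0" using h f by auto
  then have degf: "degree f = Suc (degree h)" unfolding h by (subst degree_mult_eq) auto
  have "degree h = 0"
  proof (rule ccontr)
    assume "degree h \<noteq> 0"
    then obtain x where x: "poly h x = 0" using alg_closed_imp_poly_has_root[of h] by auto
    then have hw: "poly h w = 0" using root[of x] h by auto
    have "poly (pderiv f) w = 0" unfolding h pderiv_mult by (simp add: pderiv_pCons hw)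
    moreover have "pderiv f \<noteq> 0"
      using degf by (simp add: pderiv_eq_0_iff)
    ultimately have "degree f \<le> degree (pderiv f)"
      using min f rat_poly_pderiv by (auto simp: P_def)
    then show False using degf by (simp add: degree_pderiv)
  qed
  then obtain k where k: "h = [:k:]" by (metis degree_eq_zeroE)
  \<comment> \<open>Now \<open>f\<close> is \<open>k\<close> times the linear factor of
    \<open>w\<close>, and \<open>w\<close> is up to sign the quotient of its two rational
    coefficients.\<close>
  have "coeff f 1 = k" "coeff f 0 = - (w * k)" by (auto simp: h k)
  then have "k \<in> \<rat>" "w * k \<in> \<rat>"
    using f(1) Rats_minus_iff[of "w * k"] unfolding rat_poly_def by metis+
  moreover have "k \<noteq> 0" using hnz k by auto
  ultimately have "w * k / k \<in> \<rat>" by (intro Rats_divide)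
  then show ?thesis using \<open>k \<noteq> 0\<close> by simp
qed

section \<open>Rescaled Chebyshev polynomials 2 T_n(x/2) and the conjugates of 2 cos phi\<close>

fun cheb :: "nat \<Rightarrow> complex poly" where
  "cheb 0 = [:2:]"
| "cheb (Suc 0) = [:0, 1:]"
| "cheb (Suc (Suc n)) = pCons 0 (cheb (Suc n)) - cheb n"

lemma poly_cheb:
  assumes "u \<noteq> 0"
  shows "poly (cheb n) (u + inverse u) = u ^ n + inverse u ^ n"
  using assms by (induction n rule: cheb.induct) (auto simp: field_simps)

lemma coeff_cheb_Ints: "coeff (cheb n) i \<in> \<int>"
  by (induction n arbitrary: i rule: cheb.induct) (auto simp: coeff_pCons split: nat.split)

lemma degree_cheb: "degree (cheb n) = n \<and> (n > 0 \<longrightarrow> coeff (cheb n) n = 1)"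
proof (induction n rule: cheb.induct)
  case (3 n)
  have "cheb (Suc n) \<noteq> 0" using 3 by auto
  then have d: "degree (pCons 0 (cheb (Suc n))) = Suc (Suc n)"
    using 3 by (simp add: degree_pCons_eq)
  have "coeff (cheb n) (Suc (Suc n)) = 0" using 3 by (intro coeff_eq_0) auto
  moreover have "degree (pCons 0 (cheb (Suc n)) - cheb n) \<le> Suc (Suc n)"
    using d 3 by (intro degree_diff_le) auto
  moreover have "coeff (cheb (Suc (Suc n))) (Suc (Suc n)) = 1"
    using calculation 3 by simp
  ultimately show ?case
    by (metis cheb.simps(3) le_degree one_neq_zero order_antisym)
qed auto

text \<open>Under x = u + 1/u the polynomial \<open>H\<close> becomes u^m + u^(-m) - 2, which
  vanishes only if u^m = 1. Then u lies on the unit circle and x = 2 Re u, so every root of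
  \<open>H\<close>, in particular every conjugate of 2 cos phi, is real and in [-2, 2]. Integrality
  holds because \<open>H\<close> is monic with integer coefficients.\<close>

lemma two_cos_rational_multiple_pi:
  fixes \<phi> :: real
  assumes "m > 0" and "cis \<phi> ^ m = 1"
  defines "H \<equiv> cheb m - [:2:]"
  shows "rat_poly H" "H \<noteq> 0" "poly H (of_real (2 * cos \<phi>)) = 0"
    and "\<And>x. poly H x = 0 \<Longrightarrow> \<exists>r. x = of_real r \<and> \<bar>r\<bar> \<le> 2"
    and "algebraic_int (complex_of_real (2 * cos \<phi>))"
proof -
  have H: "coeff H m = 1" "degree H \<le> m" "\<And>i. coeff H i \<in> \<int>"
    using degree_cheb[of m] assms coeff_cheb_Ints[of m]
    by (auto simp: H_def coeff_pCons split: nat.split intro!: degree_diff_le Ints_diff)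
  show "rat_poly H" using H Ints_subset_Rats by (auto simp: rat_poly_def)
  show "H \<noteq> 0" using H by auto
  have w: "complex_of_real (2 * cos \<phi>) = cis \<phi> + inverse (cis \<phi>)"
    by (simp add: complex_eq_iff)
  show r: "poly H (of_real (2 * cos \<phi>)) = 0"
    unfolding w H_def using assms poly_cheb[of "cis \<phi>" m]
    by (simp add: power_inverse del: cis_inverse)
  have "lead_coeff H = 1" using H by (metis le_degree one_neq_zero order_antisym)
  then show "algebraic_int (complex_of_real (2 * cos \<phi>))"
    using H r by (intro algebraic_int.intros[of H]) auto
  fix x assume x: "poly H x = 0"
  \<comment> \<open>Every complex \<open>x\<close> has the form u + 1/u, with u a root of u^2 - x u
    + 1.\<close>
  obtain u where u: "poly [:1, - x, 1:] u = 0"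
    using alg_closed_imp_poly_has_root[of "[:1, - x, 1:]"] by auto
  then have "u \<noteq> 0" by auto
  have xu: "x = u + inverse u" using u \<open>u \<noteq> 0\<close> by (simp add: field_simps)
  have "u ^ m + inverse u ^ m = 2" using x poly_cheb[OF \<open>u \<noteq> 0\<close>, of m] by (simp add: H_def xu)
  \<comment> \<open>Multiplication by \<open>u ^ m\<close> turns the equation into a perfect
    square.\<close>
  then have "(u ^ m - 1)\<^sup>2 = 0" using \<open>u \<noteq> 0\<close> by (simp add: field_simps power2_eq_square)
  then have "norm u ^ m = 1" by (simp flip: norm_power)
  then have n: "norm u = 1" using \<open>m > 0\<close> using power_eq_imp_eq_base[of "norm u" m 1] by simp
  have "u * cnj u = 1" using complex_norm_square[of u] n by simp
  then have "inverse u = cnj u" by (rule inverse_unique)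
  then have "x = of_real (2 * Re u)" by (simp add: xu complex_eq_iff)
  then show "\<exists>r. x = of_real r \<and> \<bar>r\<bar> \<le> 2"
    using abs_Re_le_cmod[of u] n by (intro exI[of _ "2 * Re u"]) auto
qed

section \<open>The equation between powers of the sine and of half the cosine\<close>

lemma unique_solution_decreasing_increasing:
  fixes v w :: real
  assumes "((2 - v) / 4) ^ q = ((2 + v) / 16) ^ p" "((2 - w) / 4) ^ q = ((2 + w) / 16) ^ p"
    and "\<bar>v\<bar> \<le> 2" "\<bar>w\<bar> \<le> 2" "q > 0"
  shows "v = w"
proof -
  have less: False
    if "x < y" "\<bar>x\<bar> \<le> 2" "\<bar>y\<bar> \<le> 2" "((2 - x) / 4) ^ q = ((2 + x) / 16) ^ p"
      "((2 - y) / 4) ^ q = ((2 + y) / 16) ^ p" for x y :: real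
  proof -
    \<comment> \<open>On [-2, 2] the left side of the equation strictly decreases while the right
      side does not decrease, so they agree at most once.\<close>
    have "((2 - y) / 4) ^ q < ((2 - x) / 4) ^ q" using that \<open>q > 0\<close> by (intro power_strict_mono) auto
    moreover have "((2 + x) / 16) ^ p \<le> ((2 + y) / 16) ^ p" using that by (intro power_mono) auto
    ultimately show False using that by linarith
  qed
  show ?thesis using less[of v w] less[of w v] assms by (cases v w rule: linorder_cases) auto
qed

text \<open>Both the relation and the root-of-unity condition become rational polynomial equations
  for \<open>w\<close>, and \<open>w\<close> is their only common root. Being rational and an
  algebraic integer, \<open>w\<close> is -1, 0 or 1; the values 1 and -1, that is \<theta> = \<pi>/6
  and \<theta> = \<pi>/3, fail by divisibility by 3.\<close>

lemma sin_power_eq_half_cos_power: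
  fixes \<theta> :: real
  assumes \<theta>: "0 < \<theta>" "\<theta> < pi / 2" and "m > 0" "cis (2 * \<theta>) ^ m = 1"
    and qp: "q > 0" "p > 0" and eq: "sin \<theta> ^ q = (cos \<theta> / 2) ^ p"
  shows "\<theta> = pi / 4"
proof -
  define w where "w = 2 * cos (2 * \<theta>)"
  note H = two_cos_rational_multiple_pi[OF assms(3,4), folded w_def]
  have s: "(sin \<theta>)\<^sup>2 = (2 - w) / 4" by (simp add: w_def cos_double_sin)
  have c: "(cos \<theta> / 2)\<^sup>2 = (2 + w) / 16" by (simp add: w_def cos_double_cos power_divide)
  \<comment> \<open>Squaring the relation replaces sine and cosine by expressions linear in
    \<open>w\<close>.\<close>
  have ew: "((2 - w) / 4) ^ q = ((2 + w) / 16) ^ p"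
    using eq by (metis s c power_mult mult.commute)
  have "\<bar>w\<bar> \<le> 2" by (simp add: w_def abs_mult)
  define G :: "complex poly" where "G = [:1/2, -1/4:] ^ q - [:1/8, 1/16:] ^ p"
  have G: "poly G (of_real x) = of_real (((2 - x) / 4) ^ q - ((2 + x) / 16) ^ p)" for x
    by (simp add: G_def field_simps)
  have "complex_of_real w \<in> \<rat>"
  proof (rule rational_if_only_common_root)
    show "rat_poly G" unfolding G_def
      by (intro rat_poly_diff rat_poly_power rat_poly_pCons rat_poly_0) auto
    show "poly G (of_real w) = 0" unfolding G ew by simp
    fix x assume x: "poly G x = 0" "poly (cheb m - [:2:]) x = 0"
    obtain r where r: "x = of_real r" "\<bar>r\<bar> \<le> 2" using H(4)[OF x(2)] by auto
    have "((2 - r) / 4) ^ q - ((2 + r) / 16) ^ p = 0" using x(1) unfolding r G of_real_eq_0_iff .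
    then have "r = w"
      using unique_solution_decreasing_increasing[of r q p w] ew r \<open>\<bar>w\<bar> \<le> 2\<close> qp by simp
    then show "x = of_real w" using r by simp
  qed (use H in auto)
  then have "complex_of_real w \<in> \<int>" using H(5) rational_algebraic_int_is_int by blast
  then obtain k where "complex_of_real w = of_int k" by (auto elim: Ints_cases)
  then have k: "w = of_int k" by (metis of_real_eq_iff of_real_of_int_eq)
  have "\<bar>cos (2 * \<theta>)\<bar> < 1"
    using \<theta> cos_monotone_0_pi[of 0 "2 * \<theta>"] cos_monotone_0_pi[of "2 * \<theta>" pi] by auto
  then have "\<bar>k\<bar> < 2" using k unfolding w_def by linarith
  then consider "k = 0" | "k = 1" | "k = -1" by linarith
  then show ?thesis
  proof cases
    case 1
    then have "cos (2 * \<theta>) = cos (pi / 2)" using k by (simp add: w_def)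
    then have "2 * \<theta> = pi / 2" using \<theta> using cos_inj_pi[of "2 * \<theta>" "pi / 2"] by auto
    then show ?thesis by simp
  next
    case 2
    have F: "(1 / 4 :: real) ^ q = (3 / 16) ^ p" using ew k 2 by simp
    \<comment> \<open>Clearing denominators gives an equation of integers in which one side is
      divisible by 3 and the other is a power of 16.\<close>
    have "(1 / 4 * 4 :: real) ^ q * 16 ^ p = (3 / 16 * 16) ^ p * 4 ^ q"
      unfolding power_mult_distrib F by (simp only: mult_ac)
    then have "real (16 ^ p) = real (3 ^ p * 4 ^ q)" by simp
    then have "16 ^ p = 3 ^ p * (4::nat) ^ q" by (simp only: of_nat_eq_iff)
    moreover have "(3::nat) dvd 3 ^ p * 4 ^ q" using qp by (intro dvd_mult2 dvd_power) auto
    ultimately have "(3::nat) dvd 16" using prime_dvd_power[of "3::nat" 16 p] by simp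
    then show ?thesis by simp
  next
    case 3
    have F: "(3 / 4 :: real) ^ q = (1 / 16) ^ p" using ew k 3 by simp
    have "(1 / 16 * 16 :: real) ^ p * 4 ^ q = (3 / 4 * 4) ^ q * 16 ^ p"
      unfolding power_mult_distrib F by (simp only: mult_ac)
    then have "real (4 ^ q) = real (3 ^ q * 16 ^ p)" by simp
    then have "4 ^ q = 3 ^ q * (16::nat) ^ p" by (simp only: of_nat_eq_iff)
    moreover have "(3::nat) dvd 3 ^ q * 16 ^ p" using qp by (intro dvd_mult2 dvd_power) auto
    ultimately have "(3::nat) dvd 4" using prime_dvd_power[of "3::nat" 4 q] by simp
    then show ?thesis by simp
  qed
qed

subsection \<open>Periodic tilings by right triangles\<close>

text \<open>In the plane a vector orthogonal to \<open>d\<close> is a multiple, here by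
  \<open>k\<close>, of \<open>d\<close> turned through a right angle; the rest is computation in
  coordinates.\<close>

lemma orthogonal_expansion_2:
  fixes d e w :: "real ^ 2"
  assumes "d \<bullet> e = 0" "d \<noteq> 0" "e \<noteq> 0"
  shows "w = (w \<bullet> d / (d \<bullet> d)) *\<^sub>R d + (w \<bullet> e / (e \<bullet> e)) *\<^sub>R e"
proof -
  define k where "k = (e $ 2 * d $ 1 - e $ 1 * d $ 2) / (d \<bullet> d)"
  have D: "d \<bullet> d = d $ 1 * d $ 1 + d $ 2 * d $ 2" "d \<bullet> d \<noteq> 0"
    by (simp add: inner_vec_def sum_2) (use assms in simp)
  have o: "d $ 1 * e $ 1 + d $ 2 * e $ 2 = 0" using assms(1) by (simp add: inner_vec_def sum_2)
  have kD: "k * (d \<bullet> d) = e $ 2 * d $ 1 - e $ 1 * d $ 2" using D by (simp add: k_def)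
  have "e $ 1 * (d \<bullet> d) = (- k * d $ 2) * (d \<bullet> d)" "e $ 2 * (d \<bullet> d) = (k * d $ 1) * (d \<bullet> d)"
    unfolding D(1) using o kD[unfolded D(1)] by algebra+
  then have e: "e $ 1 = - k * d $ 2" "e $ 2 = k * d $ 1" using D(2) mult_right_cancel by blast+
  have E: "e \<bullet> e = k * k * (d \<bullet> d)" "w \<bullet> e = k * (w $ 2 * d $ 1 - w $ 1 * d $ 2)"
    by (simp_all add: inner_vec_def sum_2 e algebra_simps)
  have "k \<noteq> 0" using assms(3) e by (auto simp: vec_eq_iff forall_2)
  define X where "X = w $ 2 * d $ 1 - w $ 1 * d $ 2"
  have "w \<bullet> e / (e \<bullet> e) = X / (k * (d \<bullet> d))"
    unfolding E mult.assoc X_def using \<open>k \<noteq> 0\<close> by (rule mult_divide_mult_cancel_left)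
  then have c: "w \<bullet> e / (e \<bullet> e) * (k * x) = X * x / (d \<bullet> d)" for x
    using \<open>k \<noteq> 0\<close> by simp
  have "w $ 1 * (d \<bullet> d) = (w \<bullet> d) * d $ 1 - X * d $ 2"
    "w $ 2 * (d \<bullet> d) = (w \<bullet> d) * d $ 2 + X * d $ 1"
    by (simp_all add: X_def inner_vec_def sum_2 algebra_simps)
  then have "w $ 1 = ((w \<bullet> d) * d $ 1 - X * d $ 2) / (d \<bullet> d)"
    "w $ 2 = ((w \<bullet> d) * d $ 2 + X * d $ 1) / (d \<bullet> d)"
    using D(2) by (metis nonzero_mult_div_cancel_right)+
  then show ?thesis
    using c[of "d $ 1"] c[of "d $ 2"]
    by (simp add: vec_eq_iff forall_2 e diff_divide_distrib add_divide_distrib)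
qed

text \<open>The centre of the ball is the centroid, with coefficient 1/3 along each leg. Since the
  legs are orthogonal, a displacement shorter than \<delta>/6 changes each coefficient by at most
  1/6, so both stay nonnegative with sum at most 1.\<close>

lemma ball_subset_right_triangle:
  fixes A B C :: "real ^ 2"
  assumes "(A - C) \<bullet> (B - C) = 0" "0 < \<delta>" "\<delta> \<le> norm (A - C)" "\<delta> \<le> norm (B - C)"
  shows "ball (C + (1/3) *\<^sub>R (A - C) + (1/3) *\<^sub>R (B - C)) (\<delta> / 6) \<subseteq> convex hull {A, C, B}"
proof
  fix x assume x: "x \<in> ball (C + (1/3) *\<^sub>R (A - C) + (1/3) *\<^sub>R (B - C)) (\<delta> / 6)"
  define d e where "d = A - C" and "e = B - C"
  define h where "h = x - C - (1/3) *\<^sub>R d - (1/3) *\<^sub>R e"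
  have h: "norm h < \<delta> / 6"
    using x by (simp add: h_def d_def e_def dist_norm norm_minus_commute algebra_simps)
  have de: "d \<bullet> e = 0" "d \<noteq> 0" "e \<noteq> 0" using assms by (auto simp: d_def e_def)
  have coeff: "\<bar>h \<bullet> f / (f \<bullet> f)\<bar> \<le> 1 / 6" if f: "\<delta> \<le> norm f" for f
  proof -
    have "\<bar>h \<bullet> f\<bar> \<le> norm h * norm f" by (rule Cauchy_Schwarz_ineq2)
    also have "\<dots> \<le> norm f / 6 * norm f" using h f by (intro mult_right_mono) auto
    finally have "\<bar>h \<bullet> f\<bar> \<le> (1 / 6) * (f \<bullet> f)" by (simp add: dot_square_norm power2_eq_square)
    moreover have "f \<bullet> f > 0" using f \<open>0 < \<delta>\<close> by auto
    ultimately show ?thesis by (simp add: abs_divide divide_le_eq)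
  qed
  define s t where "s = 1 / 3 + h \<bullet> d / (d \<bullet> d)" and "t = 1 / 3 + h \<bullet> e / (e \<bullet> e)"
  have st: "0 \<le> s" "0 \<le> t" "s + t \<le> 1"
    using coeff[of d] coeff[of e] assms(3,4)
    unfolding d_def[symmetric] e_def[symmetric] s_def t_def by linarith+
  have "x - C = h + (1/3) *\<^sub>R d + (1/3) *\<^sub>R e" by (simp add: h_def)
  also have "\<dots> = s *\<^sub>R d + t *\<^sub>R e"
    by (subst orthogonal_expansion_2[OF de, of h]) (simp add: s_def t_def scaleR_add_left)
  finally have "x = C + s *\<^sub>R (A - C) + t *\<^sub>R (B - C)" by (simp add: d_def e_def algebra_simps)
  then have "x \<in> convex hull {C, A, B}" using st by (auto simp: convex_hull_3_alt)
  then show "x \<in> convex hull {A, C, B}" by (simp add: insert_commute)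
qed

section \<open>Tiles up to translation, and their finiteness under two periods\<close>

fun shape :: "tile \<Rightarrow> point \<times> point" where
  "shape (A, C, B) = (A - C, B - C)"

fun right_vertex :: "tile \<Rightarrow> point" where
  "right_vertex (A, C, B) = C"

fun bounded_right_tile :: "real \<Rightarrow> real \<Rightarrow> tile \<Rightarrow> bool" where
  "bounded_right_tile \<delta> \<Delta> (A, C, B) \<longleftrightarrow> (A - C) \<bullet> (B - C) = 0 \<and>
     norm (A - C) \<in> {\<delta>..\<Delta>} \<and> norm (B - C) \<in> {\<delta>..\<Delta>}"

text \<open>Each tile contains a ball of radius \<delta>/6 about its centroid. As interiors are
  disjoint, centroids of different tiles are at least \<delta>/6 apart, and a bounded uniformly
  discrete set is finite.\<close>

lemma finite_tiles_in_bounded_region: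
  assumes \<delta>: "0 < \<delta>" and T: "\<And>t. t \<in> \<T> \<Longrightarrow> bounded_right_tile \<delta> \<Delta> t"
    and disj: "\<And>t t'. t \<in> \<T> \<Longrightarrow> t' \<in> \<T> \<Longrightarrow> t \<noteq> t' \<Longrightarrow>
      interior (region t) \<inter> interior (region t') = {}"
  shows "finite {t \<in> \<T>. norm (right_vertex t) \<le> R}"
proof -
  define X where "X = {t \<in> \<T>. norm (right_vertex t) \<le> R}"
  define ctr :: "tile \<Rightarrow> point" where
    "ctr = (\<lambda>(A, C, B). C + (1/3) *\<^sub>R (A - C) + (1/3) *\<^sub>R (B - C))"
  have ball: "ball (ctr t) (\<delta> / 6) \<subseteq> interior (region t)" if "t \<in> \<T>" for t
  proof (cases t)
    case (fields A C B)
    then show ?thesis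
      using T[OF that] \<delta> ball_subset_right_triangle[of A C B \<delta>]
      by (simp add: ctr_def interior_maximal)
  qed
  have sep: "t = t'" if "t \<in> \<T>" "t' \<in> \<T>" "dist (ctr t) (ctr t') < \<delta> / 6" for t t'
  proof (rule ccontr)
    assume "t \<noteq> t'"
    moreover have "ctr t' \<in> interior (region t)" using ball[of t] that by auto
    moreover have "ctr t' \<in> interior (region t')" using ball[of t'] that \<delta> by auto
    ultimately show False using disj that by blast
  qed
  have "inj_on ctr X" using sep \<delta> by (auto simp: X_def inj_on_def)
  moreover have "finite (ctr ` X)"
  proof -
    have "norm (ctr t) \<le> R + \<Delta>" if "t \<in> X" for t
    proof -
      obtain A C B where t: "t = (A, C, B)" by (cases t) auto
      have "norm (ctr t) \<le> norm C + norm ((1/3) *\<^sub>R (A - C)) + norm ((1/3) *\<^sub>R (B - C))"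
        unfolding t ctr_def by (simp only: prod.case) (intro norm_triangle_le add_mono order_refl)
      moreover have "norm C \<le> R" "norm (A - C) \<le> \<Delta>" "norm (B - C) \<le> \<Delta>"
        using that T[of t] by (auto simp: X_def t)
      moreover have "0 \<le> \<Delta>" using calculation norm_ge_zero order_trans by blast
      ultimately show ?thesis by simp
    qed
    then have "bounded (ctr ` X)" unfolding bounded_iff by blast
    moreover have "uniform_discrete (ctr ` X)"
      unfolding uniform_discrete_def
    proof (intro exI[of _ "\<delta> / 6"] conjI ballI impI)
      fix p p' assume "p \<in> ctr ` X" "p' \<in> ctr ` X" "dist p p' < \<delta> / 6"
      then obtain t t' where "t \<in> \<T>" "t' \<in> \<T>" "p = ctr t" "p' = ctr t'" by (auto simp: X_def)
      then show "p = p'" using sep[of t t'] \<open>dist p p' < \<delta> / 6\<close> by simp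
    qed (use \<delta> in simp)
    ultimately show ?thesis using uniform_discrete_finite_iff by blast
  qed
  ultimately show ?thesis unfolding X_def by (rule finite_imageD[rotated])
qed

lemma invariant_under_int_multiples:
  assumes "map_tile (\<lambda>x. u + x) ` \<T> = \<T>" "t \<in> \<T>"
  shows "map_tile (\<lambda>x. of_int k *\<^sub>R u + x) t \<in> \<T>"
proof (induction k rule: int_induct[where k = 0])
  case base
  show ?case using assms(2) by (cases t) simp
next
  case (step1 i)
  have "map_tile (\<lambda>x. of_int (i + 1) *\<^sub>R u + x) t
      = map_tile (\<lambda>x. u + x) (map_tile (\<lambda>x. of_int i *\<^sub>R u + x) t)"
    by (cases t) (simp add: algebra_simps)
  then show ?case using step1 assms(1) by blast
next
  case (step2 i)
  \<comment> \<open>Invariance is an equality of sets, so every tile also has a preimage; this gives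
    the negative multiples.\<close>
  obtain t' where t': "t' \<in> \<T>" "map_tile (\<lambda>x. of_int i *\<^sub>R u + x) t = map_tile (\<lambda>x. u + x) t'"
    using step2 assms(1) by blast
  then have "map_tile (\<lambda>x. of_int (i - 1) *\<^sub>R u + x) t = t'"
    by (cases t, cases t') (auto simp: algebra_simps)
  then show ?case using t' by simp
qed

text \<open>Translations by the period lattice keep the shape and bring the right vertex of any tile
  into one period parallelogram, where only finitely many tiles have theirs.\<close>

lemma finite_shapes_if_periodic:
  assumes "periodic \<T>" "0 < \<delta>" "\<And>t. t \<in> \<T> \<Longrightarrow> bounded_right_tile \<delta> \<Delta> t"
    and "\<And>t t'. t \<in> \<T> \<Longrightarrow> t' \<in> \<T> \<Longrightarrow> t \<noteq> t' \<Longrightarrow>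
      interior (region t) \<inter> interior (region t') = {}"
  shows "finite (shape ` \<T>)"
proof -
  obtain u v where uv: "u \<noteq> v" "independent {u, v}"
    and inv: "map_tile (\<lambda>x. u + x) ` \<T> = \<T>" "map_tile (\<lambda>x. v + x) ` \<T> = \<T>"
    using assms(1) by (auto simp: periodic_def)
  define Y where "Y = {t \<in> \<T>. norm (right_vertex t) \<le> norm u + norm v}"
  have "UNIV \<subseteq> span {u, v}"
    using uv by (intro card_ge_dim_independent) auto
  have "shape t \<in> shape ` Y" if "t \<in> \<T>" for t
  proof -
    have "right_vertex t \<in> span {u, v}" using \<open>UNIV \<subseteq> _\<close> by auto
    then obtain x y where xy: "right_vertex t = x *\<^sub>R u + y *\<^sub>R v"
      by (auto simp: span_breakdown_eq algebra_simps)
    \<comment> \<open>Removing the integer parts of the lattice coordinates \<open>x\<close> and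
      \<open>y\<close> leaves their fractional parts in [0, 1).\<close>
    define s where "s = map_tile (\<lambda>w. of_int (- \<lfloor>y\<rfloor>) *\<^sub>R v + w) (map_tile (\<lambda>w. of_int (- \<lfloor>x\<rfloor>) *\<^sub>R u + w) t)"
    have "s \<in> \<T>" unfolding s_def
      by (intro invariant_under_int_multiples inv that)
    moreover have "right_vertex s = frac x *\<^sub>R u + frac y *\<^sub>R v"
      using xy by (cases t) (simp add: s_def frac_def algebra_simps)
    then have "norm (right_vertex s) \<le> norm u + norm v"
      by (auto intro!: norm_triangle_le add_mono mult_left_le_one_le
          simp: frac_ge_0 less_imp_le[OF frac_lt_1])
    moreover have "shape s = shape t" by (cases t) (simp add: s_def)
    ultimately show ?thesis unfolding Y_def by (metis (mono_tags, lifting) image_eqI mem_Collect_eq)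
  qed
  moreover have "finite Y" unfolding Y_def
    using finite_tiles_in_bounded_region[OF assms(2-4)] by simp
  ultimately show ?thesis by (meson finite_imageI finite_subset image_subsetI)
qed

subsection \<open>Tiles in complex coordinates\<close>

text \<open>Identifies the complex numbers with the plane, so that turning and scaling a leg is one
  complex multiplication.\<close>

definition plane :: "complex \<Rightarrow> point" where
  "plane z = vector [Re z, Im z]"

lemma plane_nth [simp]: "plane z $ 1 = Re z" "plane z $ 2 = Im z"
  by (simp_all add: plane_def)

lemma plane_eq_iff: "plane z = plane w \<longleftrightarrow> z = w"
  by (auto simp: vec_eq_iff forall_2 complex_eq_iff)

lemma plane_diff: "plane z - plane w = plane (z - w)"
  by (simp add: vec_eq_iff forall_2)

lemma midpoint_plane: "midpoint (plane z) (plane w) = plane ((z + w) / 2)"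
  by (simp add: vec_eq_iff forall_2 midpoint_def)

lemma inner_plane: "plane z \<bullet> plane w = Re (z * cnj w)"
  by (simp add: inner_vec_def sum_2)

lemma norm_plane: "norm (plane z) = norm z"
  by (simp add: norm_vec_def L2_set_def sum_2 cmod_def)

lemma plane_affine: "plane z + r *\<^sub>R (plane w - plane z) = plane (z + of_real r * (w - z))"
  by (simp add: vec_eq_iff forall_2)

text \<open>The tile with right angle at \<open>C\<close> and long leg \<open>p\<close>; \<open>\<bar>t\<bar>\<close> is the tangent of the
  basic angle and the sign of \<open>t\<close> the handedness.\<close>

definition ctile :: "complex \<Rightarrow> complex \<Rightarrow> real \<Rightarrow> tile" where
  "ctile C p t = (plane (C + p), plane C, plane (C + \<i> * t * p))"

lemma one_plus_imaginary_nonzero: "1 + \<i> * complex_of_real t \<noteq> 0"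
  by (auto simp: complex_eq_iff)

text \<open>With \<open>X = 1 + \<i> * t\<close> the hypotenuse vector is
  \<open>(X - 2) * p\<close>, and \<open>2 - X\<close> is the conjugate of \<open>X\<close>. The
  projection coefficient 1/|X|^2 therefore cancels one factor and leaves
  \<open>- p / X\<close>.\<close>

lemma perp_foot_ctile:
  fixes t :: real
  assumes "p \<noteq> 0"
  shows "perp_foot (plane C) (plane (C + p)) (plane (C + \<i> * t * p))
    = plane (C + \<i> * t / (1 + \<i> * t) * p)"
proof -
  define X where "X = 1 + \<i> * complex_of_real t"
  have X: "X \<noteq> 0" by (simp add: X_def one_plus_imaginary_nonzero)
  have XX: "complex_of_real (1 + t\<^sup>2) = X * (2 - X)"
    by (simp add: X_def complex_eq_iff power2_eq_square)
  have t: "1 + t\<^sup>2 > 0" by (simp add: add_pos_nonneg)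
  have d: "C - (C + p) = - p" "(C + \<i> * t * p) - (C + p) = (X - 2) * p"
    by (simp_all add: X_def algebra_simps)
  have num: "(plane C - plane (C + p)) \<bullet> (plane (C + \<i> * t * p) - plane (C + p)) = (norm p)\<^sup>2"
    unfolding plane_diff inner_plane d cmod_power2
    by (simp add: X_def power2_eq_square algebra_simps)
  have den: "(plane (C + \<i> * t * p) - plane (C + p)) \<bullet> (plane (C + \<i> * t * p) - plane (C + p))
      = (1 + t\<^sup>2) * (norm p)\<^sup>2"
  proof -
    have "(norm (X - 2))\<^sup>2 = 1 + t\<^sup>2" by (simp add: X_def cmod_power2)
    then show ?thesis
      by (simp only: plane_diff d dot_square_norm norm_plane norm_mult power_mult_distrib)
  qed
  have "perp_foot (plane C) (plane (C + p)) (plane (C + \<i> * t * p))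
      = plane (C + p + of_real (1 / (1 + t\<^sup>2)) * ((X - 2) * p))"
    unfolding perp_foot_def num den plane_affine d(2) using assms by simp
  also have "of_real (1 / (1 + t\<^sup>2)) * ((X - 2) * p) = - p / X"
  proof -
    define Y where "Y = 2 - X"
    have Y: "X - 2 = - Y" by (simp add: Y_def)
    have "Y \<noteq> 0" using XX t unfolding Y_def by (metis less_irrefl mult_zero_right of_real_eq_0_iff)
    then have "1 / (X * (2 - X)) * ((X - 2) * p) = - p / X"
      unfolding Y Y_def[symmetric] by simp
    then show ?thesis by (simp only: of_real_divide of_real_1 XX)
  qed
  also have "C + p + - p / X = C + \<i> * t / (1 + \<i> * t) * p"
  proof -
    have "\<i> * t / (1 + \<i> * t) = 1 - 1 / X"
      using X by (simp add: X_def field_simps)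
    then show ?thesis unfolding \<open>\<i> * t / (1 + \<i> * t) = 1 - 1 / X\<close> by (simp add: algebra_simps)
  qed
  finally show ?thesis .
qed

text \<open>Only legs and handedness matter later, so the right vertices \<open>F\<close>,
  \<open>K\<close>, \<open>N\<close> are quantified away. The order is that of
  \<open>daughters\<close>. The third daughter keeps \<open>t\<close>, so the same factor recurs
  when it is taken repeatedly; the fifth flips the sign of \<open>t\<close>.\<close>

lemma daughters_ctile:
  fixes t :: real
  assumes "p \<noteq> 0"
  defines "q \<equiv> p / (2 * (1 + \<i> * t))"
  shows "\<exists>F K N. daughters (ctile C p t) =
    {ctile N q (- t), ctile K q (- t), ctile K q t, ctile N (- q) t,
     ctile F (- (\<i> * t / (1 + \<i> * t)) * p) (- t)}"
proof -
  define X where "X = 1 + \<i> * complex_of_real t"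
  have X: "X \<noteq> 0" "\<i> * complex_of_real t = X - 1" by (simp_all add: X_def one_plus_imaginary_nonzero)
  define r where "r = \<i> * t / (1 + \<i> * t) * p"
  have r: "r = p - 2 * q" and q: "X * q = p / 2"
    using X(1) unfolding r_def q_def X_def[symmetric] X(2) by (simp_all add: field_simps)
  define F M N K where "F = C + r" and "M = C + p / 2"
    and "N = C + (p + r) / 2" and "K = C + r / 2"
  have mid: "midpoint (plane (C + p)) (plane C) = plane M"
    "midpoint (plane (C + p)) (plane F) = plane N" "midpoint (plane F) (plane C) = plane K"
    by (simp_all add: midpoint_plane F_def M_def N_def K_def field_simps)
  have D: "daughters (ctile C p t) =
    {(plane (C + p), plane N, plane M), (plane M, plane K, plane C), (plane M, plane K, plane F),
     (plane F, plane N, plane M), (plane C, plane F, plane (C + \<i> * t * p))}"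
    unfolding ctile_def daughters.simps perp_foot_ctile[OF assms(1)] r_def[symmetric] F_def[symmetric]
      Let_def mid ..
  have "X * r = X * p - p" using q by (simp add: r algebra_simps)
  \<comment> \<open>The short legs of the daughters, found from \<open>\<i> * t = X - 1\<close> and
    \<open>X * q = p / 2\<close>.\<close>
  then have iq: "\<i> * t * q = r / 2" "\<i> * t * r = (\<i> * t * p) - r"
    unfolding X(2) using q by (simp_all add: r algebra_simps)
  have eqs: "N + q = C + p" "N - \<i> * t * q = M" "K + q = M" "K - \<i> * t * q = C" "K + \<i> * t * q = F"
    "N - q = F" "F - r = C" "F + \<i> * t * r = C + \<i> * t * p"
    unfolding iq by (simp_all add: r F_def M_def N_def K_def field_simps)
  have T: "(plane (C + p), plane N, plane M) = ctile N q (- t)"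
    "(plane M, plane K, plane C) = ctile K q (- t)"
    "(plane M, plane K, plane F) = ctile K q t"
    "(plane F, plane N, plane M) = ctile N (- q) t"
    "(plane C, plane F, plane (C + \<i> * t * p)) = ctile F (- r) (- t)"
    using eqs by (simp_all add: ctile_def)
  have "- (\<i> * t / (1 + \<i> * t)) * p = - r" by (simp add: r_def)
  then show ?thesis using D unfolding T by metis
qed

lemma norm_one_plus_imaginary: "norm (1 + \<i> * complex_of_real t) = sqrt (1 + t\<^sup>2)"
  by (simp add: cmod_def)

lemma hypotenuse_ctile: "hypotenuse (ctile C p t) = norm p * sqrt (1 + t\<^sup>2)"
proof -
  have "dist (plane (C + p)) (plane (C + \<i> * t * p)) = norm (p * (1 - \<i> * t))"
    by (simp add: dist_norm plane_diff norm_plane algebra_simps)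
  then show ?thesis
    using norm_one_plus_imaginary[of "- t"] by (simp add: ctile_def norm_mult)
qed

section \<open>Similarities of the plane\<close>

lemma euclidean_rescaling_differences:
  assumes "euclidean_motion e" "rescaling s"
  shows "\<exists>r U. 0 < r \<and> orthogonal_transformation U \<and>
    (\<forall>x y. (e \<circ> s) x - (e \<circ> s) y = r *\<^sub>R U (x - y))"
proof -
  obtain r where r: "0 < r" "s = (\<lambda>x. r *\<^sub>R x)" using assms(2) by (auto simp: rescaling_def)
  \<comment> \<open>An isometry fixing the origin is linear and orthogonal; the translation part of
    \<open>e\<close> drops out of differences.\<close>
  define U where "U x = e x - e 0" for x
  have U: "orthogonal_transformation U"
    unfolding orthogonal_transformation_isometry
    using assms(1) by (auto simp: U_def euclidean_motion_def dist_norm)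
  then interpret linear U by (rule orthogonal_transformation_linear)
  have "(e \<circ> s) x - (e \<circ> s) y = r *\<^sub>R U (x - y)" for x y
  proof -
    have "(e \<circ> s) x - (e \<circ> s) y = U (r *\<^sub>R x) - U (r *\<^sub>R y)" by (simp add: U_def r)
    then show ?thesis by (simp add: scaleR diff scaleR_diff_right)
  qed
  then show ?thesis using r U by blast
qed

lemma supertile_similarity:
  assumes "supertile a b n S"
  obtains f r U where "S = map_tile f ` stage a b n" "orthogonal_transformation U" "0 < r"
    "\<And>x y. f x - f y = r *\<^sub>R U (x - y)"
proof -
  obtain e s where es: "euclidean_motion e" "rescaling s" "S = map_tile (e \<circ> s) ` stage a b n"
    using assms unfolding supertile_def by blast
  obtain r U where "0 < r" "orthogonal_transformation U"
    "\<And>x y. (e \<circ> s) x - (e \<circ> s) y = r *\<^sub>R U (x - y)"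
    using euclidean_rescaling_differences[OF es(1,2)] by blast
  then show ?thesis using that[of "e \<circ> s" U r] es(3) by blast
qed

subsection \<open>The stages of the subdivision\<close>

locale basic_triangle =
  fixes a b c :: real
  assumes pos: "0 < a" "0 < b" "0 < c" and pythagoras: "a\<^sup>2 + b\<^sup>2 = c\<^sup>2"
begin

text \<open>The linear factors of the two kinds of daughters, half the cosine and the sine of the
  basic angle; \<open>\<tau>\<close> is its tangent.\<close>

definition \<alpha> :: real where "\<alpha> = b / (2 * c)"
definition \<beta> :: real where "\<beta> = a / c"
definition \<tau> :: real where "\<tau> = a / b"

lemma less_c: "a < c" "b < c"
proof -
  have "a\<^sup>2 < c\<^sup>2" "b\<^sup>2 < c\<^sup>2" using pos pythagoras by (smt (verit) zero_less_power)+
  then show "a < c" "b < c" using pos by (auto intro: power2_less_imp_less)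
qed

lemma ratios: "0 < \<alpha>" "\<alpha> < 1" "0 < \<beta>" "\<beta> < 1" "0 < \<tau>"
  using pos less_c by (auto simp: \<alpha>_def \<beta>_def \<tau>_def)

lemma sqrt_\<tau>: "sqrt (1 + \<tau>\<^sup>2) = c / b"
proof -
  have "1 + \<tau>\<^sup>2 = (c / b)\<^sup>2" using pos pythagoras by (simp add: \<tau>_def field_simps)
  then show ?thesis using pos by simp
qed

text \<open>The complex factors of the daughters have the prescribed linear factors as absolute
  values. The hypothesis on squares covers both orientations.\<close>

lemma norm_factors:
  assumes "t\<^sup>2 = \<tau>\<^sup>2"
  shows "norm (1 / (2 * (1 + \<i> * complex_of_real t))) = \<alpha>"
    and "norm (\<i> * complex_of_real t / (1 + \<i> * complex_of_real t)) = \<beta>"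
proof -
  have n: "norm (1 + \<i> * complex_of_real t) = c / b"
    using norm_one_plus_imaginary[of t] assms sqrt_\<tau> by simp
  have "\<bar>t\<bar> = \<tau>" using assms ratios by (simp add: power2_eq_iff) auto
  then show "norm (\<i> * complex_of_real t / (1 + \<i> * complex_of_real t)) = \<beta>"
    using pos by (simp add: norm_divide norm_mult n \<tau>_def \<beta>_def)
  show "norm (1 / (2 * (1 + \<i> * complex_of_real t))) = \<alpha>"
    unfolding norm_divide norm_mult n using pos by (simp add: \<alpha>_def)
qed

text \<open>The invariant of all stages: either handedness, and a size that records how often each
  kind of daughter was taken.\<close>

definition tree_tile :: "tile \<Rightarrow> bool" where
  "tree_tile s \<longleftrightarrow> (\<exists>C p t i j. s = ctile C p t \<and> t\<^sup>2 = \<tau>\<^sup>2 \<and> norm p = b * \<alpha> ^ i * \<beta> ^ j)"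

lemma hypotenuse_tree_ctile: "t\<^sup>2 = \<tau>\<^sup>2 \<Longrightarrow> hypotenuse (ctile C p t) = norm p * c / b"
  by (simp add: hypotenuse_ctile sqrt_\<tau>)

lemma hypotenuse_tree_tile:
  assumes "tree_tile s"
  shows "\<exists>i j. hypotenuse s = c * \<alpha> ^ i * \<beta> ^ j" "0 < hypotenuse s"
proof -
  obtain C p t i j where s: "s = ctile C p t" "t\<^sup>2 = \<tau>\<^sup>2" "norm p = b * \<alpha> ^ i * \<beta> ^ j"
    using assms(1) unfolding tree_tile_def by blast
  then have "hypotenuse s = c * \<alpha> ^ i * \<beta> ^ j"
    using hypotenuse_tree_ctile[OF s(2), of C p] pos by simp
  then show "\<exists>i j. hypotenuse s = c * \<alpha> ^ i * \<beta> ^ j" "0 < hypotenuse s" using pos ratios by auto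
qed

lemma daughters_tree_tile:
  assumes "tree_tile s" "d \<in> daughters s"
  shows "tree_tile d" "hypotenuse d \<in> {\<alpha> * hypotenuse s, \<beta> * hypotenuse s}"
proof -
  obtain C p t i j where s: "s = ctile C p t" "t\<^sup>2 = \<tau>\<^sup>2" "norm p = b * \<alpha> ^ i * \<beta> ^ j"
    using assms(1) unfolding tree_tile_def by blast
  have "p \<noteq> 0" using s pos ratios by auto
  define q where "q = p / (2 * (1 + \<i> * t))"
  define r where "r = - (\<i> * t / (1 + \<i> * t)) * p"
  have nq: "norm q = \<alpha> * norm p"
  proof -
    have "q = 1 / (2 * (1 + \<i> * t)) * p" by (simp add: q_def)
    then show ?thesis by (simp only: norm_mult norm_factors(1)[OF s(2)])
  qed
  have nr: "norm r = \<beta> * norm p"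
    unfolding r_def norm_mult norm_minus_cancel norm_factors(2)[OF s(2)] ..
  obtain F K N where "daughters s = {ctile N q (- t), ctile K q (- t), ctile K q t,
      ctile N (- q) t, ctile F r (- t)}"
    using daughters_ctile[OF \<open>p \<noteq> 0\<close>, of C t] unfolding s q_def r_def by blast
  then have "d = ctile N q (- t) \<or> d = ctile K q (- t) \<or> d = ctile K q t \<or>
      d = ctile N (- q) t \<or> d = ctile F r (- t)"
    using assms(2) by simp
  moreover have "(- t)\<^sup>2 = \<tau>\<^sup>2" "norm (- q) = \<alpha> * norm p" using s(2) nq by simp_all
  ultimately obtain C' p' t' where d: "d = ctile C' p' t'" "t'\<^sup>2 = \<tau>\<^sup>2"
    and p': "norm p' = \<alpha> * norm p \<or> norm p' = \<beta> * norm p"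
    using s(2) nq nr by blast
  show "hypotenuse d \<in> {\<alpha> * hypotenuse s, \<beta> * hypotenuse s}"
    using p' hypotenuse_tree_ctile[OF d(2)] hypotenuse_tree_ctile[OF s(2)] by (auto simp: d(1) s(1))
  have "norm p' = b * \<alpha> ^ Suc i * \<beta> ^ j \<or> norm p' = b * \<alpha> ^ i * \<beta> ^ Suc j"
    using p' s(3) by auto
  then show "tree_tile d" using d unfolding tree_tile_def by blast
qed

lemma basic_tile_eq: "basic_tile a b = ctile 0 b \<tau>"
  using pos by (simp add: basic_tile_def ctile_def \<tau>_def vec_eq_iff forall_2)

definition largest :: "nat \<Rightarrow> real" where
  "largest n = Max (hypotenuse ` stage a b n)"

lemma in_stage_Suc:
  "s \<in> stage a b (Suc n) \<longleftrightarrow> (s \<in> stage a b n \<and> hypotenuse s \<noteq> largest n) \<or>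
     (\<exists>r\<in>stage a b n. hypotenuse r = largest n \<and> s \<in> daughters r)"
  by (auto simp: subdivide_largest_def largest_def split: if_splits)

lemma tree_tile_stage: "s \<in> stage a b n \<Longrightarrow> tree_tile s"
proof (induction n arbitrary: s)
  case 0
  have "norm (complex_of_real b) = b * \<alpha> ^ 0 * \<beta> ^ 0" using pos by simp
  moreover have "s = ctile 0 b \<tau>" using 0 by (simp add: basic_tile_eq)
  ultimately show ?case unfolding tree_tile_def by blast
next
  case (Suc n)
  then show ?case unfolding in_stage_Suc using daughters_tree_tile(1) by blast
qed

lemma hypotenuse_le_largest: "s \<in> stage a b n \<Longrightarrow> hypotenuse s \<le> largest n"
  by (simp add: largest_def finite_stage)

lemma daughters_nonempty: "daughters s \<noteq> {}"
  by (cases s) (simp add: Let_def)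

lemma stage_nonempty: "stage a b n \<noteq> {}"
proof (induction n)
  case (Suc n)
  then obtain s where "s \<in> stage a b n" by blast
  then show ?case using daughters_nonempty[of s] by (auto simp: subdivide_largest_def)
qed simp

lemma largest_attained: "\<exists>s\<in>stage a b n. hypotenuse s = largest n"
proof -
  have "largest n \<in> hypotenuse ` stage a b n"
    unfolding largest_def using stage_nonempty finite_stage by (intro Max_in) auto
  then show ?thesis by (metis imageE)
qed

lemma largest_pos: "0 < largest n"
  using largest_attained hypotenuse_tree_tile(2) tree_tile_stage by metis

lemma largest_decreasing: "largest (Suc n) < largest n"
proof -
  obtain s where s: "s \<in> stage a b (Suc n)" "hypotenuse s = largest (Suc n)"
    using largest_attained by blast
  from s(1) consider "s \<in> stage a b n" "hypotenuse s \<noteq> largest n"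
    | r where "r \<in> stage a b n" "hypotenuse r = largest n" "s \<in> daughters r"
    unfolding in_stage_Suc by blast
  then show ?thesis
  proof cases
    case 1
    then show ?thesis using s(2) hypotenuse_le_largest[of s n] by simp
  next
    case 2
    then have "hypotenuse s \<in> {\<alpha> * largest n, \<beta> * largest n}"
      using daughters_tree_tile(2)[OF tree_tile_stage, of r n s] by simp
    then show ?thesis using s(2) ratios largest_pos[of n] by auto
  qed
qed

text \<open>Only tiles of the largest size are divided, so a new tile is at least
  \<open>min \<alpha> \<beta>\<close> times that size, and the largest size only decreases. This
  makes the sizes within a stage comparable, uniformly in \<open>n\<close>.\<close>

lemma hypotenuse_ge_fraction_largest:
  "s \<in> stage a b n \<Longrightarrow> min \<alpha> \<beta> * largest n \<le> hypotenuse s"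
proof (induction n arbitrary: s)
  case 0
  have "largest 0 = hypotenuse s" using 0 by (simp add: largest_def)
  then show ?case using ratios largest_pos[of 0] by (simp add: min_def mult_le_cancel_right1)
next
  case (Suc n)
  have "min \<alpha> \<beta> * largest (Suc n) \<le> min \<alpha> \<beta> * largest n"
    using largest_decreasing[of n] ratios by (intro mult_left_mono) auto
  also have "\<dots> \<le> hypotenuse s"
    using Suc.prems unfolding in_stage_Suc
  proof (elim disjE conjE bexE)
    fix r assume "r \<in> stage a b n" "hypotenuse r = largest n" "s \<in> daughters r"
    then have "hypotenuse s \<in> {\<alpha> * largest n, \<beta> * largest n}"
      using daughters_tree_tile(2)[OF tree_tile_stage, of r n s] by simp
    then show ?thesis using largest_pos[of n] by (auto intro!: mult_right_mono)
  qed (use Suc.IH in blast)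
  finally show ?case .
qed

text \<open>Both ratios are below 1, so a lower bound on the size bounds the exponents
  \<open>i\<close> and \<open>j\<close>.\<close>

lemma finite_large_tree_sizes:
  assumes "0 < \<delta>"
  shows "finite {x. (\<exists>i j. x = c * \<alpha> ^ i * \<beta> ^ j) \<and> \<delta> \<le> x}"
proof -
  define \<gamma> where "\<gamma> = max \<alpha> \<beta>"
  have \<gamma>: "0 < \<gamma>" "\<gamma> < 1" "\<alpha> \<le> \<gamma>" "\<beta> \<le> \<gamma>" using ratios by (auto simp: \<gamma>_def)
  obtain n where n: "\<gamma> ^ n < \<delta> / c" using real_arch_pow_inv[of "\<delta> / c" \<gamma>] \<gamma> assms pos by auto
  have "i < n \<and> j < n" if "\<delta> \<le> c * \<alpha> ^ i * \<beta> ^ j" for i j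
  proof -
    have "\<alpha> ^ i * \<beta> ^ j \<le> \<gamma> ^ i * \<gamma> ^ j" using \<gamma> ratios by (intro mult_mono power_mono) auto
    moreover have "\<delta> / c \<le> \<alpha> ^ i * \<beta> ^ j" using that pos by (simp add: field_simps)
    ultimately have "\<gamma> ^ n < \<gamma> ^ (i + j)" using n by (simp add: power_add)
    then have "i + j < n" using \<gamma> by (meson linorder_not_less power_decreasing less_imp_le)
    then show ?thesis by simp
  qed
  then have "{x. (\<exists>i j. x = c * \<alpha> ^ i * \<beta> ^ j) \<and> \<delta> \<le> x}
      \<subseteq> (\<lambda>(i, j). c * \<alpha> ^ i * \<beta> ^ j) ` ({..<n} \<times> {..<n})"
    by force
  then show ?thesis by (rule finite_subset) simp
qed

text \<open>Otherwise the strictly decreasing sequence \<open>largest\<close> would take infinitely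
  many values in a finite set of sizes.\<close>

lemma largest_eventually_small:
  assumes "0 < \<delta>"
  shows "\<exists>n0. \<forall>n\<ge>n0. largest n < \<delta>"
proof -
  have anti: "largest n < largest m" if "m < n" for m n
    using that by (induction rule: less_Suc_induct) (auto intro: largest_decreasing)
  have "\<exists>n. largest n < \<delta>"
  proof (rule ccontr)
    assume "\<not> ?thesis"
    moreover have "\<exists>i j. largest n = c * \<alpha> ^ i * \<beta> ^ j" for n
      using largest_attained[of n] hypotenuse_tree_tile(1) tree_tile_stage by metis
    ultimately have "range largest \<subseteq> {x. (\<exists>i j. x = c * \<alpha> ^ i * \<beta> ^ j) \<and> \<delta> \<le> x}"
      by (auto simp: not_less)
    then have "finite (range largest)" using finite_large_tree_sizes[OF assms] finite_subset by blast
    moreover have "inj largest"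
      by (rule injI) (metis anti less_irrefl linorder_neqE_nat)
    ultimately show False using finite_imageD infinite_UNIV_nat by blast
  qed
  then show ?thesis using anti by (metis le_less less_trans)
qed

subsection \<open>A spiral of tiles\<close>

definition \<theta> :: real where "\<theta> = arcsin (a / c)"
text \<open>The factor by which the daughter \<open>(M, K, F)\<close> multiplies the long leg of a
  tile with \<open>t = \<tau>\<close>.\<close>

definition \<omega> :: complex where "\<omega> = 1 / (2 * (1 + \<i> * \<tau>))"

lemma sin_cos_\<theta>: "sin \<theta> = \<beta>" "cos \<theta> / 2 = \<alpha>" "0 < \<theta>" "\<theta> < pi / 2"
proof -
  have ac: "0 < a / c" "a / c < 1" using pos less_c by simp_all
  then show "sin \<theta> = \<beta>" unfolding \<theta>_def \<beta>_def by (intro sin_arcsin) linarith+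
  have "cos \<theta> = sqrt (1 - (a / c)\<^sup>2)" unfolding \<theta>_def using ac by (intro cos_arcsin) linarith+
  also have "1 - (a / c)\<^sup>2 = (b / c)\<^sup>2"
    using pos pythagoras by (simp add: power_divide field_simps)
  finally show "cos \<theta> / 2 = \<alpha>" using pos by (simp add: \<alpha>_def)
  show "0 < \<theta>" "\<theta> < pi / 2"
    using ac arcsin_less_arcsin[of 0 "a / c"] arcsin_less_arcsin[of "a / c" 1]
    unfolding \<theta>_def by simp_all
qed

lemma \<omega>_polar: "\<omega> = of_real \<alpha> * cis (- \<theta>)"
proof -
  have "cos \<theta> = b / c" using sin_cos_\<theta>(2) by (simp add: \<alpha>_def)
  then have polar: "1 + \<i> * \<tau> = of_real (c / b) * cis \<theta>"
    using pos sin_cos_\<theta>(1) by (simp add: complex_eq_iff \<tau>_def \<beta>_def)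
  show ?thesis
    unfolding \<omega>_def polar cis_inverse[symmetric] using pos
    by (simp add: \<alpha>_def field_simps del: cis_inverse)
qed

text \<open>The factor acquired by the long leg along \<open>j\<close> successive daughters of type \<open>(C, F, B)\<close>,
  the handedness alternating.\<close>

fun fold_factor :: "nat \<Rightarrow> complex" where
  "fold_factor 0 = 1"
| "fold_factor (Suc j) =
    - (\<i> * complex_of_real ((-1) ^ j * \<tau>) / (1 + \<i> * complex_of_real ((-1) ^ j * \<tau>)))
      * fold_factor j"

lemma norm_fold_factor: "norm (fold_factor j) = \<beta> ^ j"
proof (induction j)
  case (Suc j)
  have "((-1) ^ j * \<tau>)\<^sup>2 = \<tau>\<^sup>2" by (simp add: power_mult_distrib flip: power_mult)
  from norm_factors(2)[OF this] show ?case
    unfolding fold_factor.simps norm_mult norm_minus_cancel Suc by (simp only: power_Suc)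
qed simp

text \<open>Two successive folds have opposite handedness, hence conjugate factors of absolute value
  \<open>\<beta>\<close>; their product is real, so there is no rotation.\<close>

lemma fold_factor_add_2: "fold_factor (Suc (Suc j)) = of_real (\<beta>\<^sup>2) * fold_factor j"
proof -
  define s where "s = (-1) ^ j * \<tau>"
  define D where "D t = 1 + \<i> * complex_of_real t" for t
  define A where "A t = \<i> * complex_of_real t / D t" for t
  have "fold_factor (Suc j) = - A s * fold_factor j"
    "fold_factor (Suc (Suc j)) = - A (- s) * fold_factor (Suc j)"
    unfolding fold_factor.simps(2)[of j] fold_factor.simps(2)[of "Suc j"] A_def D_def s_def
    by simp_all
  then have "fold_factor (Suc (Suc j)) = A s * A (- s) * fold_factor j" by simp
  also have "A s * A (- s) = of_real (\<beta>\<^sup>2)"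
  proof -
    have "s\<^sup>2 = \<tau>\<^sup>2" by (simp add: s_def power_mult_distrib flip: power_mult)
    then have "D s * D (- s) = of_real (1 + \<tau>\<^sup>2)"
      "(\<i> * complex_of_real s) * (\<i> * complex_of_real (- s)) = of_real (\<tau>\<^sup>2)"
      by (simp_all add: D_def complex_eq_iff power2_eq_square)
    moreover have "\<tau>\<^sup>2 / (1 + \<tau>\<^sup>2) = \<beta>\<^sup>2"
    proof -
      have "1 + \<tau>\<^sup>2 = (c / b)\<^sup>2" using pos pythagoras by (simp add: \<tau>_def field_simps)
      then show ?thesis using pos by (simp add: \<tau>_def \<beta>_def power_divide)
    qed
    ultimately show ?thesis
      unfolding A_def times_divide_times_eq by (simp only: flip: of_real_divide)
  qed
  finally show ?thesis .
qed

lemma fold_factor_same_parity: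
  "fold_factor (2 * k + r) = of_real (\<beta> ^ (2 * k)) * fold_factor r"
proof (induction k)
  case (Suc k)
  have "2 * Suc k + r = Suc (Suc (2 * k + r))" by simp
  then show ?case unfolding \<open>2 * Suc k + r = _\<close> fold_factor_add_2 Suc
    by (simp add: power2_eq_square)
qed simp

text \<open>Descend from the basic tile \<open>i\<close> times to \<open>(M, K, F)\<close> and from
  then on always to \<open>(C, F, B)\<close>. Every stage contains a tile of this path: the current
  one survives, or it is divided and the next one appears. The first alternative is the case of
  fewer than \<open>i\<close> steps.\<close>

lemma spiral_tiles_in_stage:
  "(\<exists>C k. k < i \<and> ctile C (b * \<omega> ^ k) \<tau> \<in> stage a b n) \<or>
   (\<exists>C j. ctile C (b * \<omega> ^ i * fold_factor j) ((-1) ^ j * \<tau>) \<in> stage a b n)"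
proof (induction n)
  case 0
  have "ctile 0 (b * \<omega> ^ 0) \<tau> \<in> stage a b 0"
    "ctile 0 (b * \<omega> ^ 0 * fold_factor 0) ((-1) ^ 0 * \<tau>) \<in> stage a b 0"
    by (simp_all add: basic_tile_eq)
  then show ?case by (cases i) blast+
next
  case (Suc n)
  have step: "s \<in> stage a b (Suc n) \<or> d \<in> stage a b (Suc n)"
    if "s \<in> stage a b n" "d \<in> daughters s" for s d
    using that unfolding in_stage_Suc by blast
  have "\<omega> \<noteq> 0" using ratios by (simp add: \<omega>_polar)
  have fnz: "fold_factor j \<noteq> 0" for j using norm_fold_factor[of j] ratios by auto
  from Suc show ?case
  proof (elim disjE exE conjE)
    fix C k assume k: "k < i" "ctile C (b * \<omega> ^ k) \<tau> \<in> stage a b n"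
    have "b * \<omega> ^ k \<noteq> 0" using pos \<open>\<omega> \<noteq> 0\<close> by simp
    from daughters_ctile[OF this, of C \<tau>] obtain K
      where "ctile K (b * \<omega> ^ Suc k) \<tau> \<in> daughters (ctile C (b * \<omega> ^ k) \<tau>)"
      by (auto simp: \<omega>_def)
    then consider "ctile C (b * \<omega> ^ k) \<tau> \<in> stage a b (Suc n)"
      | "ctile K (b * \<omega> ^ Suc k) \<tau> \<in> stage a b (Suc n)" using step k by blast
    then show ?thesis
    proof cases
      case 1
      then show ?thesis using k by blast
    next
      case 2
      show ?thesis
      proof (cases "Suc k = i")
        case True
        then have "ctile K (b * \<omega> ^ i * fold_factor 0) ((-1) ^ 0 * \<tau>) \<in> stage a b (Suc n)"
          using 2 by simp
        then show ?thesis by blast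
      next
        case False
        then show ?thesis using 2 k(1) by (metis Suc_lessI)
      qed
    qed
  next
    fix C j assume j: "ctile C (b * \<omega> ^ i * fold_factor j) ((-1) ^ j * \<tau>) \<in> stage a b n"
    have "b * \<omega> ^ i * fold_factor j \<noteq> 0" using pos \<open>\<omega> \<noteq> 0\<close> fnz by simp
    from daughters_ctile[OF this, of C "(-1) ^ j * \<tau>"] obtain F
      where "ctile F (- (\<i> * complex_of_real ((-1) ^ j * \<tau>) / (1 + \<i> * complex_of_real ((-1) ^ j * \<tau>))) *
          (b * \<omega> ^ i * fold_factor j)) (- ((-1) ^ j * \<tau>))
        \<in> daughters (ctile C (b * \<omega> ^ i * fold_factor j) ((-1) ^ j * \<tau>))"
      by blast
    moreover have "- (\<i> * complex_of_real ((-1) ^ j * \<tau>) / (1 + \<i> * complex_of_real ((-1) ^ j * \<tau>))) *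
          (b * \<omega> ^ i * fold_factor j) = b * \<omega> ^ i * fold_factor (Suc j)"
      by (simp only: fold_factor.simps mult_ac)
    moreover have "- ((-1) ^ j * \<tau>) = (-1) ^ Suc j * \<tau>" by simp
    ultimately have "ctile F (b * \<omega> ^ i * fold_factor (Suc j)) ((-1) ^ Suc j * \<tau>)
        \<in> daughters (ctile C (b * \<omega> ^ i * fold_factor j) ((-1) ^ j * \<tau>))"
      by (simp only:)
    then show ?thesis using step[OF j] j by blast
  qed
qed

text \<open>A tile after only \<open>k < i\<close> steps has hypotenuse
  \<open>c * \<alpha> ^ k\<close>, at least \<open>c * \<alpha> ^ m\<close>; late stages have no
  tile that large, so the path has reached its second phase.\<close>

lemma spiral_tiles_in_late_stage:
  "\<exists>n0. \<forall>n\<ge>n0. \<forall>i<m. \<exists>C j. ctile C (b * \<omega> ^ i * fold_factor j) ((-1) ^ j * \<tau>) \<in> stage a b n"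
proof -
  obtain n0 where n0: "\<And>n. n \<ge> n0 \<Longrightarrow> largest n < c * \<alpha> ^ m"
    using largest_eventually_small[of "c * \<alpha> ^ m"] pos ratios by auto
  have "\<exists>C j. ctile C (b * \<omega> ^ i * fold_factor j) ((-1) ^ j * \<tau>) \<in> stage a b n"
    if "n \<ge> n0" "i < m" for n i
  proof (rule ccontr)
    assume "\<not> ?thesis"
    then obtain C k where k: "k < i" "ctile C (b * \<omega> ^ k) \<tau> \<in> stage a b n"
      using spiral_tiles_in_stage by blast
    have "norm \<omega> = \<alpha>" using ratios by (simp add: \<omega>_polar norm_mult)
    then have "hypotenuse (ctile C (b * \<omega> ^ k) \<tau>) = c * \<alpha> ^ k"
      using pos by (simp add: hypotenuse_tree_ctile norm_mult norm_power)
    then have "c * \<alpha> ^ k < c * \<alpha> ^ m"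
      using hypotenuse_le_largest[OF k(2)] n0[OF that(1)] by simp
    moreover have "\<alpha> ^ m \<le> \<alpha> ^ k" using ratios k(1) that(2) by (intro power_decreasing) auto
    ultimately show False using pos by simp
  qed
  then show ?thesis by blast
qed

lemma shape_ctile: "shape (ctile C p t) = (plane p, plane (\<i> * t * p))"
  by (simp add: ctile_def plane_diff)

text \<open>Equal short legs force equal handedness, so \<open>j\<close> and \<open>j'\<close> have
  the same parity and the folds contribute the same direction. Comparing directions gives a root of
  unity, comparing lengths a relation between powers of \<open>\<alpha>\<close> and
  \<open>\<beta>\<close>. Together they force \<theta> = \<pi>/4, where
  \<open>\<beta> ^ 3 = \<alpha>\<close>.\<close>

lemma coinciding_shapes_imp_third:
  assumes eq: "shape (ctile C (b * \<omega> ^ i * fold_factor j) ((-1) ^ j * \<tau>))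
      = shape (ctile C' (b * \<omega> ^ i' * fold_factor j') ((-1) ^ j' * \<tau>))"
    and "i < i'"
  shows "ln \<beta> / ln \<alpha> = 1 / 3"
proof -
  define p p' where "p = b * \<omega> ^ i * fold_factor j" and "p' = b * \<omega> ^ i' * fold_factor j'"
  have "p = p'" "\<i> * complex_of_real ((-1) ^ j * \<tau>) * p = \<i> * complex_of_real ((-1) ^ j' * \<tau>) * p'"
    using eq unfolding p_def[symmetric] p'_def[symmetric] shape_ctile prod.inject plane_eq_iff
    by blast+
  have "norm \<omega> = \<alpha>" using ratios by (simp add: \<omega>_polar norm_mult)
  then have n: "norm p = b * \<alpha> ^ i * \<beta> ^ j" "norm p' = b * \<alpha> ^ i' * \<beta> ^ j'"
    using pos by (simp_all add: p_def p'_def norm_mult norm_power norm_fold_factor)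
  then have "p \<noteq> 0" using pos ratios by auto
  then have "complex_of_real ((-1) ^ j * \<tau>) = complex_of_real ((-1) ^ j' * \<tau>)"
    using \<open>\<i> * _ * p = _\<close> unfolding \<open>p = p'\<close>[symmetric]
    by (metis complex_i_not_zero mult_cancel_left mult_cancel_right)
  then have "(-1 :: real) ^ j = (-1) ^ j'"
    unfolding of_real_eq_iff using ratios by simp
  then have parity: "j mod 2 = j' mod 2" by (cases "even j"; cases "even j'") (auto simp: mod2_eq_if)
  have spiral: "\<omega> ^ i * fold_factor j = \<omega> ^ i' * fold_factor j'"
    using \<open>p = p'\<close> pos by (simp add: p_def p'_def)
  have ab: "\<alpha> ^ i * \<beta> ^ j = \<alpha> ^ i' * \<beta> ^ j'" using n \<open>p = p'\<close> pos by simp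
  \<comment> \<open>Up to the positive factor \<open>\<beta> ^ l\<close>, the fold factor depends
    only on the parity of \<open>l\<close>.\<close>
  have fj: "fold_factor l = of_real (\<beta> ^ l / \<beta> ^ (l mod 2)) * fold_factor (l mod 2)" for l
  proof -
    have "l = 2 * (l div 2) + l mod 2" by simp
    then have "fold_factor l = of_real (\<beta> ^ (2 * (l div 2))) * fold_factor (l mod 2)"
      "\<beta> ^ l = \<beta> ^ (2 * (l div 2)) * \<beta> ^ (l mod 2)"
      by (metis fold_factor_same_parity) (metis mult_div_mod_eq power_add)
    then show ?thesis using ratios by simp
  qed
  have polar: "\<omega> ^ k * fold_factor l = of_real (\<alpha> ^ k * \<beta> ^ l) *
      (cis (- \<theta>) ^ k * (fold_factor (l mod 2) / of_real (\<beta> ^ (l mod 2))))" for k l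
    by (subst fj) (simp add: \<omega>_polar power_mult_distrib)
  have "fold_factor (j mod 2) \<noteq> 0" using norm_fold_factor[of "j mod 2"] ratios by auto
  then have "cis (- \<theta>) ^ i = cis (- \<theta>) ^ i'"
    using spiral ratios unfolding polar ab parity by simp
  also have "\<dots> = cis (- \<theta>) ^ i * cis (- \<theta>) ^ (i' - i)"
    using \<open>i < i'\<close> by (simp flip: power_add)
  finally have "cis (- \<theta>) ^ (i' - i) = 1" by simp
  \<comment> \<open>The root of unity at angle \<open>- \<theta>\<close> is transferred to the angle
    \<open>2 * \<theta>\<close> by multiplying with its square.\<close>
  then have "cis (2 * \<theta>) ^ (i' - i) = cis (2 * \<theta>) ^ (i' - i) * (cis (- \<theta>) ^ (i' - i)) ^ 2" by simp
  also have "\<dots> = (cis (2 * \<theta>) * cis (- \<theta>) ^ 2) ^ (i' - i)"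
    by (simp only: power_mult_distrib mult.commute flip: power_mult)
  also have "cis (2 * \<theta>) * cis (- \<theta>) ^ 2 = 1" by (simp add: power2_eq_square cis_mult)
  finally have root: "cis (2 * \<theta>) ^ (i' - i) = 1" by simp
  have sizes: "\<beta> ^ j = \<alpha> ^ (i' - i) * \<beta> ^ j'"
    using ab \<open>i < i'\<close> ratios power_add[of \<alpha> i "i' - i"] by simp
  have "\<alpha> ^ (i' - i) < 1" using ratios \<open>i < i'\<close> by (simp add: power_less_one_iff)
  then have "\<beta> ^ j < \<beta> ^ j'" using sizes ratios by simp
  then have "j' < j" using ratios by (simp add: power_strict_decreasing_iff)
  then have "\<beta> ^ (j - j') = \<alpha> ^ (i' - i)"
    using sizes ratios power_add[of \<beta> "j - j'" j'] by simp
  then have quarter: "\<theta> = pi / 4"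
    using sin_power_eq_half_cos_power[of \<theta> "i' - i" "j - j'" "i' - i"] root \<open>i < i'\<close> \<open>j' < j\<close> sin_cos_\<theta>
    by simp
  then have ab: "\<beta> = sqrt 2 / 2" "\<alpha> = sqrt 2 / 4"
    using sin_cos_\<theta>(1,2) unfolding quarter sin_45 cos_45 by simp_all
  have "\<beta> ^ 3 = \<alpha>" unfolding ab by (simp add: power3_eq_cube)
  then have "ln \<alpha> = 3 * ln \<beta>" using ratios ln_realpow[of \<beta> 3] by simp
  moreover have "ln \<beta> \<noteq> 0" using ratios ln_less_zero[of \<beta>] by simp
  ultimately show ?thesis by simp
qed

lemma many_shapes_in_late_stage:
  assumes "ln \<beta> / ln \<alpha> \<noteq> 1 / 3"
  shows "\<exists>n0. \<forall>n\<ge>n0. m \<le> card (shape ` stage a b n)"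
proof -
  obtain n0 where n0: "\<And>n i. n \<ge> n0 \<Longrightarrow> i < m \<Longrightarrow>
      \<exists>C j. ctile C (b * \<omega> ^ i * fold_factor j) ((-1) ^ j * \<tau>) \<in> stage a b n"
    using spiral_tiles_in_late_stage[of m] by blast
  have "m \<le> card (shape ` stage a b n)" if "n \<ge> n0" for n
  proof -
    obtain C j where Cj: "\<And>i. i < m \<Longrightarrow>
        ctile (C i) (b * \<omega> ^ i * fold_factor (j i)) ((-1) ^ j i * \<tau>) \<in> stage a b n"
      using n0[OF \<open>n \<ge> n0\<close>] by metis
    define f where "f i = shape (ctile (C i) (b * \<omega> ^ i * fold_factor (j i)) ((-1) ^ j i * \<tau>))" for i
    \<comment> \<open>Distinctness of the shapes does not depend on membership in a stage, so it
      holds even for \<open>i \<ge> m\<close>, where \<open>C i\<close> and \<open>j i\<close> are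
      arbitrary.\<close>
    have "inj f"
    proof (rule linorder_injI)
      fix i i' :: nat assume "i < i'"
      then show "f i \<noteq> f i'" using coinciding_shapes_imp_third assms unfolding f_def by blast
    qed
    moreover have "f ` {..<m} \<subseteq> shape ` stage a b n" using Cj by (auto simp: f_def)
    ultimately show ?thesis
      using card_inj_on_le[of f "{..<m}" "shape ` stage a b n"] finite_stage
      by (simp add: inj_on_subset)
  qed
  then show ?thesis by blast
qed

section \<open>Transfer from stages to supertiles and tilings\<close>

lemma similar_tree_tile:
  assumes "tree_tile t" "orthogonal_transformation U" "0 < r"
    "\<And>x y. f x - f y = r *\<^sub>R U (x - y)"
  shows "bounded_right_tile (min a b / c * (r * hypotenuse t)) (r * hypotenuse t) (map_tile f t)"
    and "hypotenuse (map_tile f t) = r * hypotenuse t"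
proof -
  obtain C p s where t: "t = ctile C p s" "s\<^sup>2 = \<tau>\<^sup>2"
    using assms(1) unfolding tree_tile_def by blast
  have "\<bar>s\<bar> = \<tau>" using t ratios by (simp add: power2_eq_iff) auto
  have h: "hypotenuse t = norm p * c / b" using hypotenuse_tree_ctile t by simp
  have U: "U x \<bullet> U y = x \<bullet> y" "norm (U x) = norm x" for x y
    using assms(2) by (auto simp: orthogonal_transformation_def orthogonal_transformation_norm)
  have legs: "norm (f (plane (C + p)) - f (plane C)) = b / c * (r * hypotenuse t)"
    "norm (f (plane (C + \<i> * s * p)) - f (plane C)) = a / c * (r * hypotenuse t)"
    using assms(3) pos by (simp_all add: assms(4) U plane_diff norm_plane h norm_mult \<open>\<bar>s\<bar> = \<tau>\<close> \<tau>_def)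
  moreover have "(f (plane (C + p)) - f (plane C)) \<bullet> (f (plane (C + \<i> * s * p)) - f (plane C)) = 0"
    by (simp add: assms(4) U plane_diff inner_plane)
  moreover have "min a b / c * x \<le> b / c * x" "min a b / c * x \<le> a / c * x" if "0 \<le> x" for x
    using pos that by (auto intro!: mult_right_mono divide_right_mono)
  moreover have "b / c * x \<le> x" "a / c * x \<le> x" if "0 \<le> x" for x
    using pos less_c that by (intro mult_left_le_one_le; simp)+
  moreover have "0 \<le> r * hypotenuse t" using assms(3) h pos by simp
  ultimately show "bounded_right_tile (min a b / c * (r * hypotenuse t)) (r * hypotenuse t) (map_tile f t)"
    by (simp add: t ctile_def)
  show "hypotenuse (map_tile f t) = r * hypotenuse t"
    using assms(3) by (simp add: t ctile_def dist_norm assms(4) U)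
qed

text \<open>A similarity acts on shapes by an injective linear map. It may change each shape, but
  not their number, which is why cardinalities are compared.\<close>

lemma card_shapes_similar:
  assumes "orthogonal_transformation U" "0 < r" "\<And>x y. f x - f y = r *\<^sub>R U (x - y)"
  shows "card (shape ` map_tile f ` X) = card (shape ` X)"
proof -
  define g where "g = map_prod (\<lambda>x. r *\<^sub>R U x) (\<lambda>x. r *\<^sub>R U x)"
  have "shape (map_tile f t) = g (shape t)" for t
    by (cases t) (simp add: g_def assms(3))
  then have "shape ` map_tile f ` X = g ` shape ` X" by (simp add: image_image)
  moreover have "inj (\<lambda>x. r *\<^sub>R U x)"
    using orthogonal_transformation_inj[OF assms(1)] assms(2) by (intro injI) (simp add: inj_eq)
  then have "inj g" unfolding g_def using prod.inj_map by blast
  ultimately show ?thesis by (simp add: card_image inj_on_subset)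
qed

lemma supertile_tiles:
  assumes "supertile a b n S" "t \<in> S"
  shows "0 < hypotenuse t"
    and "bounded_right_tile (min a b / c * hypotenuse t) (hypotenuse t) t"
    and "t' \<in> S \<Longrightarrow> min \<alpha> \<beta> * hypotenuse t \<le> hypotenuse t'"
proof -
  from supertile_similarity[OF assms(1)] obtain f r U where S: "S = map_tile f ` stage a b n"
    and rU: "orthogonal_transformation U" "0 < r" "\<And>x y. f x - f y = r *\<^sub>R U (x - y)" by metis
  note sim = similar_tree_tile[OF tree_tile_stage rU]
  obtain x where x: "x \<in> stage a b n" "t = map_tile f x" using assms(2) S by blast
  show "0 < hypotenuse t"
    using sim(2)[OF x(1)] x(2) rU(2) hypotenuse_tree_tile(2)[OF tree_tile_stage[OF x(1)]] by simp
  show "bounded_right_tile (min a b / c * hypotenuse t) (hypotenuse t) t"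
    using sim[OF x(1)] x(2) by simp
  assume "t' \<in> S"
  then obtain x' where x': "x' \<in> stage a b n" "t' = map_tile f x'" using S by blast
  have "min \<alpha> \<beta> * hypotenuse x \<le> min \<alpha> \<beta> * largest n"
    using hypotenuse_le_largest[OF x(1)] ratios by (intro mult_left_mono) auto
  also have "\<dots> \<le> hypotenuse x'" using x'(1) by (rule hypotenuse_ge_fraction_largest)
  finally have "r * (min \<alpha> \<beta> * hypotenuse x) \<le> r * hypotenuse x'" using rU(2) by simp
  then show "min \<alpha> \<beta> * hypotenuse t \<le> hypotenuse t'"
    using sim(2)[OF x(1)] sim(2)[OF x'(1)] x(2) x'(2) by (simp add: mult.left_commute)
qed

text \<open>Any two tiles lie in a common supertile, so all sizes are comparable with that of one
  fixed tile. Periodicity would then leave finitely many shapes, whereas supertiles of high order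
  have arbitrarily many.\<close>

lemma hierarchical_not_periodic:
  assumes "ln \<beta> / ln \<alpha> \<noteq> 1 / 3" "hierarchical_tiling a b c \<T>"
  shows "\<not> periodic \<T>"
proof
  assume "periodic \<T>"
  obtain S :: "nat \<Rightarrow> tile set" and N :: "nat \<Rightarrow> nat" where T: "\<T> = (\<Union>i. S i)"
    and N: "strict_mono N" and sup: "\<And>i. supertile a b (N i) (S i)" and sub: "\<And>i. S i \<subset> S (Suc i)"
    using assms(2) unfolding hierarchical_tiling_def by blast
  have disj: "\<And>t t'. t \<in> \<T> \<Longrightarrow> t' \<in> \<T> \<Longrightarrow> t \<noteq> t' \<Longrightarrow>
      interior (region t) \<inter> interior (region t') = {}"
    using assms(2) unfolding hierarchical_tiling_def plane_tiling_def by blast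
  have mono: "S i \<subseteq> S j" if "i \<le> j" for i j
    using sub by (intro lift_Suc_mono_le[OF _ that]) auto
  have common: "\<exists>i. t \<in> S i \<and> t' \<in> S i" if tt': "t \<in> \<T>" "t' \<in> \<T>" for t t'
  proof -
    obtain i j where "t \<in> S i" "t' \<in> S j" using tt' T by blast
    then have "t \<in> S (max i j)" "t' \<in> S (max i j)" using mono[of i "max i j"] mono[of j "max i j"] by auto
    then show ?thesis by blast
  qed
  obtain t0 where t0: "t0 \<in> \<T>" using sub[of 0] T by blast
  define h0 where "h0 = hypotenuse t0"
  define m where "m = min \<alpha> \<beta>"
  have "0 < m" using ratios by (simp add: m_def)
  have "0 < h0" using supertile_tiles(1)[OF sup] t0 T unfolding h0_def by blast
  have bounded: "bounded_right_tile (min a b / c * (m * h0)) (h0 / m) t" if "t \<in> \<T>" for t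
  proof -
    obtain i where i: "t \<in> S i" "t0 \<in> S i" using common[OF \<open>t \<in> \<T>\<close> t0] by blast
    define h where "h = hypotenuse t"
    have h: "m * h0 \<le> h" "m * h \<le> h0"
      using supertile_tiles(3)[OF sup i(2,1)] supertile_tiles(3)[OF sup i] by (simp_all add: h_def h0_def m_def)
    have "min a b / c * (m * h0) \<le> min a b / c * h" using pos h by (intro mult_left_mono) auto
    moreover have "h \<le> h0 / m" using h \<open>0 < m\<close> by (simp add: field_simps)
    moreover have "bounded_right_tile (min a b / c * h) h t"
      using supertile_tiles(2)[OF sup i(1)] h_def by simp
    ultimately show ?thesis by (cases t) auto
  qed
  have "0 < min a b / c * (m * h0)" using pos \<open>0 < m\<close> \<open>0 < h0\<close> by simp
  then have fin: "finite (shape ` \<T>)"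
    using finite_shapes_if_periodic[OF \<open>periodic \<T>\<close> _ bounded disj] by blast
  obtain n0 where n0: "\<And>n. n \<ge> n0 \<Longrightarrow> Suc (card (shape ` \<T>)) \<le> card (shape ` stage a b n)"
    using many_shapes_in_late_stage[OF assms(1)] by blast
  \<comment> \<open>The orders increase strictly, so the supertile with index \<open>n0\<close>
    already has order at least \<open>n0\<close>.\<close>
  have "n0 \<le> N n0" using N by (rule seq_suble)
  from supertile_similarity[OF sup[of n0]] have "card (shape ` S n0) = card (shape ` stage a b (N n0))"
    by (metis card_shapes_similar)
  moreover have "card (shape ` S n0) \<le> card (shape ` \<T>)"
    using T by (intro card_mono fin) auto
  ultimately show False using n0[OF \<open>n0 \<le> N n0\<close>] by simp
qed

end

theorem mainTheorem5:
  fixes a b c \<theta> z :: real and \<T> :: "tile set"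
  assumes "0 < a" "0 < b" "0 < c" "a\<^sup>2 + b\<^sup>2 = c\<^sup>2"
    and "0 < \<theta>" "\<theta> < pi / 2" "\<theta> = arcsin (a / c)"
    and "z = ln (sin \<theta>) / ln (cos \<theta> / 2)"
    and "z \<noteq> 1 / 3"
    and "hierarchical_tiling a b c \<T>"
  shows "\<not> periodic \<T>"
proof -
  interpret basic_triangle a b c using assms(1-4) by unfold_locales
  have "z = ln \<beta> / ln \<alpha>"
    using assms(7,8) sin_cos_\<theta>(1,2) by (simp add: \<theta>_def)
  then show ?thesis using hierarchical_not_periodic assms(9,10) by simp
qed

end
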